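(* Let $D$ be a Dedekind domain that is not a field and let $M$ be a finitely generated $D$-module with torsion submodule $\tau(M)$. Then $$M\text{ is a C4}^*\text{-module}\iff \operatorname{rank}_D M\le1\text{ and }\tau(M)\text{ is a C4}^*\text{-module}.$$
   Context: A module $M$ is a C4-module if, whenever $M=A\oplus B$ (internal direct sum) and $f:A\to B$ is a homomorphism such that $\ker f$ is a direct summand of $A$, the image $\operatorname{Im} f$ is a direct summand of $B$. A module is a C4$^*$-module if every submodule of it is a C4-module. $\tau(M)=\{x\in M: xd=0\text{ for some }0\ne d\in D\}$, and $\operatorname{rank}_D M=\dim_K(K\otimes_D M)$ with $K$ the fraction field of $D$. *)

theory Defs
  imports
    "HOL-Computational_Algebra.Polynomial_Factorial"
    "HOL-Algebra.Ring_Divisibility"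
    "HOL-Algebra.Free_Abelian_Groups"
    "Jordan_Normal_Form.VS_Connect"
begin

text \<open>
  The ring \<open>D\<close> is a type of class \<open>idom\<close>, its fraction field \<open>K\<close> is the type
  \<open>'a fract\<close>, and a \<open>D\<close>-module is a type with a scalar multiplication \<open>scale\<close> satisfying
  the locale \<open>Modules.module\<close>; a submodule is a set satisfying \<open>Modules.module.subspace scale\<close>.
  The \<open>HOL-Algebra\<close> view \<open>class_ring\<close> of a ring type gives access to the ideal-theoretic
  predicates and to dimensions of vector spaces whose carrier is a set of cosets.
\<close>

subsection \<open>Dedekind domains\<close>

text \<open>
  Noetherian, of Krull dimension at most one, and integrally closed in the fraction field.
  Fields satisfy this.
\<close>

definition dedekind_domain :: "'a::idom itself \<Rightarrow> bool" where
  "dedekind_domain (_ :: 'a itself) \<longleftrightarrow>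
     noetherian_ring (class_ring :: 'a ring) \<and>
     (\<forall>P. primeideal P (class_ring :: 'a ring) \<and> P \<noteq> {0}
        \<longrightarrow> maximalideal P (class_ring :: 'a ring)) \<and>
     (\<forall>(x :: 'a fract) (p :: 'a poly).
        lead_coeff p = 1 \<and> poly (map_poly to_fract p) x = 0 \<longrightarrow> x \<in> range to_fract)"

subsection \<open>C4-modules\<close>

definition internal_direct_sum ::
    "('a::comm_ring_1 \<Rightarrow> 'b::ab_group_add \<Rightarrow> 'b) \<Rightarrow> 'b set \<Rightarrow> 'b set \<Rightarrow> 'b set \<Rightarrow> bool" where
  "internal_direct_sum scale N A B \<longleftrightarrow>
     Modules.module.subspace scale A \<and> Modules.module.subspace scale B \<and>
     A \<inter> B = {0} \<and> N = {a + b | a b. a \<in> A \<and> b \<in> B}"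

definition direct_summand ::
    "('a::comm_ring_1 \<Rightarrow> 'b::ab_group_add \<Rightarrow> 'b) \<Rightarrow> 'b set \<Rightarrow> 'b set \<Rightarrow> bool" where
  "direct_summand scale A N \<longleftrightarrow> (\<exists>B. internal_direct_sum scale N A B)"

text \<open>
  Only the values of \<open>f\<close> on \<open>A\<close> matter: a homomorphism defined on a submodule need not
  extend to the ambient module, so the locale \<open>module_hom\<close> would be too restrictive.
\<close>

definition submodule_hom ::
    "('a::comm_ring_1 \<Rightarrow> 'b::ab_group_add \<Rightarrow> 'b) \<Rightarrow> 'b set \<Rightarrow> 'b set \<Rightarrow> ('b \<Rightarrow> 'b) \<Rightarrow> bool" where
  "submodule_hom scale A B f \<longleftrightarrow>
     f \<in> A \<rightarrow> B \<and>
     (\<forall>x\<in>A. \<forall>y\<in>A. f (x + y) = f x + f y) \<and>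
     (\<forall>c. \<forall>x\<in>A. f (scale c x) = scale c (f x))"

text \<open>In the next two definitions \<open>N\<close> is a submodule of the ambient module.\<close>

definition C4_module ::
    "('a::comm_ring_1 \<Rightarrow> 'b::ab_group_add \<Rightarrow> 'b) \<Rightarrow> 'b set \<Rightarrow> bool" where
  "C4_module scale N \<longleftrightarrow>
     (\<forall>A B f. internal_direct_sum scale N A B \<and> submodule_hom scale A B f \<and>
        direct_summand scale {x \<in> A. f x = 0} A
        \<longrightarrow> direct_summand scale (f ` A) B)"

definition C4_star_module ::
    "('a::comm_ring_1 \<Rightarrow> 'b::ab_group_add \<Rightarrow> 'b) \<Rightarrow> 'b set \<Rightarrow> bool" where
  "C4_star_module scale N \<longleftrightarrow>
     (\<forall>L. Modules.module.subspace scale L \<and> L \<subseteq> N \<longrightarrow> C4_module scale L)"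

subsection \<open>Torsion and rank\<close>

definition torsion_submodule ::
    "('a::comm_ring_1 \<Rightarrow> 'b::ab_group_add \<Rightarrow> 'b) \<Rightarrow> 'b set" where
  "torsion_submodule scale = {x. \<exists>d. d \<noteq> 0 \<and> scale d x = 0}"

text \<open>
  \<open>K \<otimes>\<^sub>D M\<close> is the free abelian group on \<open>K \<times> M\<close> modulo the subgroup generated by the
  relations making \<open>(k, m) \<mapsto> k \<otimes> m\<close> biadditive and \<open>D\<close>-balanced.
\<close>

definition tensor_relations ::
    "('a::idom \<Rightarrow> 'b::ab_group_add \<Rightarrow> 'b) \<Rightarrow> ('a fract \<times> 'b \<Rightarrow>\<^sub>0 int) set" where
  "tensor_relations scale =
     {frag_of (k + k', m) - frag_of (k, m) - frag_of (k', m) | k k' m. True} \<union>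
     {frag_of (k, m + m') - frag_of (k, m) - frag_of (k, m') | k m m'. True} \<union>
     {frag_of (k * to_fract d, m) - frag_of (k, scale d m) | k d m. True}"

abbreviation free_pairs :: "('a::idom fract \<times> 'b \<Rightarrow>\<^sub>0 int) monoid" where
  "free_pairs \<equiv> free_Abelian_group UNIV"

definition tensor_kernel ::
    "('a::idom \<Rightarrow> 'b::ab_group_add \<Rightarrow> 'b) \<Rightarrow> ('a fract \<times> 'b \<Rightarrow>\<^sub>0 int) set" where
  "tensor_kernel scale = generate free_pairs (tensor_relations scale)"

text \<open>
  The scalar \<open>k\<close> acts by \<open>l \<otimes> m \<mapsto> (k * l) \<otimes> m\<close>. On a coset \<open>C\<close> this is the image of \<open>C\<close>
  under the induced endomorphism of the free group, saturated to a full coset. The record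
  fields \<open>mult\<close> and \<open>one\<close> play no role in a module.
\<close>

definition fract_tensor ::
    "('a::idom \<Rightarrow> 'b::ab_group_add \<Rightarrow> 'b) \<Rightarrow>
     ('a fract, ('a fract \<times> 'b \<Rightarrow>\<^sub>0 int) set) module" where
  "fract_tensor scale =
     \<lparr>carrier = carrier (free_pairs Mod tensor_kernel scale),
      monoid.mult = undefined,
      monoid.one = undefined,
      ring.zero = \<one>\<^bsub>free_pairs Mod tensor_kernel scale\<^esub>,
      ring.add = (\<lambda>C C'. C \<otimes>\<^bsub>free_pairs Mod tensor_kernel scale\<^esub> C'),
      module.smult = (\<lambda>k C. tensor_kernel scale <#>\<^bsub>free_pairs\<^esub>
                       frag_extend (\<lambda>(l, m). frag_of (k * l, m)) ` C)\<rparr>"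

text \<open>
  \<open>vectorspace.dim\<close> is the least size of a finite generating set, hence meaningful when
  \<open>K \<otimes>\<^sub>D M\<close> is finite-dimensional, in particular for finitely generated \<open>M\<close>.
\<close>

definition module_rank :: "('a::idom \<Rightarrow> 'b::ab_group_add \<Rightarrow> 'b) \<Rightarrow> nat" where
  "module_rank scale = vectorspace.dim (class_ring :: 'a fract ring) (fract_tensor scale)"

definition finitely_generated_module ::
    "('a::comm_ring_1 \<Rightarrow> 'b::ab_group_add \<Rightarrow> 'b) \<Rightarrow> bool" where
  "finitely_generated_module scale \<longleftrightarrow> (\<exists>S. finite S \<and> Modules.module.span scale S = UNIV)"

end

theory Submission
  imports Defs
begin

text \<open>
  The rank is at most one iff any two elements of \<open>M\<close> are linearly dependent over \<open>D\<close>.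
  If \<open>x\<close> and \<open>y\<close> are independent and \<open>d\<close> is a nonzero nonunit, then \<open>r x \<mapsto> r d y\<close> violates C4 in
  \<open>D x \<oplus> D y\<close>, as \<open>D d y\<close> is not a summand of \<open>D y\<close>. Conversely, let the rank be at most one and
  let \<open>f: A \<rightarrow> B\<close> with \<open>A \<oplus> B \<subseteq> M\<close>. One of \<open>A\<close>, \<open>B\<close> is torsion. If \<open>B\<close> is, then so is a complement
  of \<open>ker f\<close> in \<open>A\<close>. If \<open>A\<close> is, then \<open>f\<close> maps into \<open>\<tau>(B)\<close>, which is a summand of \<open>B\<close> because \<open>B/\<tau>(B)\<close> is
  isomorphic to an ideal of \<open>D\<close>, hence projective. In both cases C4 for a torsion module applies.
\<close>

section \<open>Ideals of Dedekind domains\<close>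

lemma ideal_class_ring_iff:
  "ideal I (class_ring :: 'a::comm_ring_1 ring) \<longleftrightarrow>
     0 \<in> I \<and> (\<forall>x\<in>I. \<forall>y\<in>I. x + y \<in> I) \<and> (\<forall>c. \<forall>x\<in>I. c * x \<in> I)"
  (is "?L \<longleftrightarrow> ?R")
proof
  assume ?L
  then interpret ideal I "class_ring :: 'a ring" .
  show ?R
    using zero_closed a_closed I_l_closed by (auto simp: class_ring_simps)
next
  assume R: ?R
  have neg: "- x \<in> I" if "x \<in> I" for x
    using R that by (metis mult_minus1)
  show ?L
  proof (rule idealI)
    show "ring (class_ring :: 'a ring)" by (rule class_ring.ring_axioms)
    have inv: "inv\<^bsub>add_monoid (class_ring :: 'a ring)\<^esub> x = - x" for x :: 'a
      using fun_cong[OF class_ring_simps(8), of x] by (simp only: a_inv_def)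
    show "subgroup I (add_monoid (class_ring :: 'a ring))"
      by (rule group.subgroupI[OF abelian_group.a_group[OF class_ring.is_abelian_group]])
        (use R neg inv in auto)
  next
    fix a x assume "a \<in> I" "x \<in> carrier (class_ring :: 'a ring)"
    with R show "x \<otimes>\<^bsub>class_ring\<^esub> a \<in> I" by simp
    with R show "a \<otimes>\<^bsub>class_ring\<^esub> x \<in> I" by (simp add: mult.commute)
  qed
qed

text \<open>In a Noetherian ring the union of a nonempty chain of ideals is a member of the chain.
  Zorn's lemma therefore applies inside any nonempty family of ideals.\<close>

lemma noetherian_ring_maximal:
  assumes "noetherian_ring R" "\<And>I. I \<in> F \<Longrightarrow> ideal I R" "F \<noteq> {}"
  obtains M where "M \<in> F" "\<And>I. I \<in> F \<Longrightarrow> M \<subseteq> I \<Longrightarrow> I = M"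
proof -
  interpret noetherian_ring R by fact
  have "\<Union>C \<in> F" if "C \<noteq> {}" and chain: "subset.chain F C" for C
  proof -
    have "C \<subseteq> F" using chain by (simp add: subset_chain_def)
    moreover have "C \<subseteq> {I. ideal I R}" using \<open>C \<subseteq> F\<close> assms(2) by auto
    then have "subset.chain {I. ideal I R} C" using chain by (simp add: subset_chain_def)
    then have "\<Union>C \<in> C" by (rule ideal_chain_is_trivial[OF \<open>C \<noteq> {}\<close>])
    ultimately show ?thesis by (rule subsetD)
  qed
  then have "\<exists>M\<in>F. \<forall>X\<in>F. M \<subseteq> X \<longrightarrow> X = M"
    by (rule subset_Zorn_nonempty[OF assms(3)])
  then show thesis using that by auto
qed

text \<open>The ideals \<open>J n\<close> generated by \<open>p 0, ..., p n\<close> increase, so a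
  maximal one satisfies \<open>J (Suc n) = J n\<close>, and \<open>p (Suc n)\<close> lies in
  it.\<close>

lemma noetherian_sequence_dependent:
  fixes p :: "nat \<Rightarrow> 'a::comm_ring_1"
  assumes "noetherian_ring (class_ring :: 'a ring)"
  obtains n c where "p (Suc n) = (\<Sum>i\<le>n. c i * p i)"
proof -
  define J where "J n = {\<Sum>i\<le>n. c i * p i | c. True}" for n
  have ideal: "ideal (J n) class_ring" for n
    unfolding ideal_class_ring_iff
  proof (intro conjI ballI allI)
    show "0 \<in> J n"
      unfolding J_def by (auto intro: exI[of _ "\<lambda>_. 0"])
  next
    fix x y assume "x \<in> J n" "y \<in> J n"
    then obtain c d where "x = (\<Sum>i\<le>n. c i * p i)" "y = (\<Sum>i\<le>n. d i * p i)"
      unfolding J_def by blast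
    then have "x + y = (\<Sum>i\<le>n. (c i + d i) * p i)"
      by (simp add: distrib_right sum.distrib)
    then show "x + y \<in> J n" unfolding J_def by (auto intro: exI[of _ "\<lambda>i. c i + d i"])
  next
    fix r x assume "x \<in> J n"
    then obtain c where "x = (\<Sum>i\<le>n. c i * p i)"
      unfolding J_def by blast
    then have "r * x = (\<Sum>i\<le>n. (r * c i) * p i)"
      by (simp add: sum_distrib_left mult.assoc)
    then show "r * x \<in> J n" unfolding J_def by (auto intro: exI[of _ "\<lambda>i. r * c i"])
  qed
  obtain M where M: "M \<in> range J" "\<And>I. I \<in> range J \<Longrightarrow> M \<subseteq> I \<Longrightarrow> I = M"
    by (rule noetherian_ring_maximal[OF assms, of "range J"]) (use ideal in auto)
  then obtain n where n: "M = J n" by blast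
  have "J n \<subseteq> J (Suc n)"
  proof
    fix x assume "x \<in> J n"
    then obtain c where "x = (\<Sum>i\<le>n. c i * p i)"
      unfolding J_def by blast
    then have "x = (\<Sum>i\<le>Suc n. (c(Suc n := 0)) i * p i)" by simp
    then show "x \<in> J (Suc n)" unfolding J_def by blast
  qed
  then have "J (Suc n) = J n" using M n by blast
  moreover have "p (Suc n) \<in> J (Suc n)"
  proof -
    have "p (Suc n) = (\<Sum>i\<le>Suc n. (if i = Suc n then 1 else 0) * p i)" by simp
    then show ?thesis
      unfolding J_def by (intro CollectI exI[of _ "\<lambda>i. if i = Suc n then 1 else 0"]) simp
  qed
  ultimately show thesis using that unfolding J_def by blast
qed

section \<open>Integral closedness and invertibility of ideals\<close>

text \<open>All powers of \<open>x = \<beta>/\<alpha>\<close> have the common denominator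
  \<open>p 0\<close>, because \<open>p n = x ^ n * p 0\<close> lies in D. Over a Noetherian domain
  this makes \<open>x\<close> integral, hence an element of D.\<close>

lemma dedekind_domain_dvd:
  fixes \<alpha> \<beta> :: "'a::idom"
  assumes D: "dedekind_domain TYPE('a)" and "\<alpha> \<noteq> 0" "p 0 \<noteq> 0"
    and rec: "\<And>n::nat. \<alpha> * p (Suc n) = \<beta> * p n"
  shows "\<alpha> dvd \<beta>"
proof -
  define x where "x = Fract \<beta> \<alpha>"
  have ax: "to_fract \<alpha> * x = to_fract \<beta>"
    using \<open>\<alpha> \<noteq> 0\<close> by (simp add: x_def to_fract_def eq_fract)
  have pow: "to_fract (p n) = x ^ n * to_fract (p 0)" for n
  proof (induction n)
    case (Suc n)
    have "to_fract \<alpha> * to_fract (p (Suc n)) = to_fract \<beta> * to_fract (p n)"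
      by (metis rec to_fract_mult)
    also have "\<dots> = to_fract \<alpha> * (x * to_fract (p n))"
      by (simp flip: ax)
    finally show ?case using \<open>\<alpha> \<noteq> 0\<close> Suc by (simp add: mult.assoc)
  qed simp
  obtain n c where nc: "p (Suc n) = (\<Sum>i\<le>n. c i * p i)"
    using noetherian_sequence_dependent D unfolding dedekind_domain_def by blast
  have sum: "to_fract (sum f A) = (\<Sum>i\<in>A. to_fract (f i))" for f :: "nat \<Rightarrow> 'a" and A
    by (induction A rule: infinite_finite_induct) auto
  have "x ^ Suc n * to_fract (p 0) = to_fract (\<Sum>i\<le>n. c i * p i)"
    using pow nc by metis
  also have "\<dots> = (\<Sum>i\<le>n. to_fract (c i) * (x ^ i * to_fract (p 0)))"
    unfolding sum to_fract_mult by (subst pow) simp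
  also have "\<dots> = (\<Sum>i\<le>n. to_fract (c i) * x ^ i) * to_fract (p 0)"
    by (simp add: sum_distrib_right mult.assoc)
  finally have eq: "x ^ Suc n = (\<Sum>i\<le>n. to_fract (c i) * x ^ i)"
    using \<open>p 0 \<noteq> 0\<close> by simp
  \<comment> \<open>These are the coefficients of the monic polynomial that expresses
    \<open>eq\<close> as an equation of integrality for \<open>x\<close>.\<close>
  define a where "a i = (if i = Suc n then 1 else if i \<le> n then - c i else 0)" for i
  define q where "q = (\<Sum>i\<le>Suc n. monom (a i) i)"
  have coeff: "coeff q i = a i" for i
    by (simp add: q_def coeff_sum sum.delta a_def del: sum.atMost_Suc)
  have deg: "degree q = Suc n"
    by (rule antisym[OF degree_le le_degree]) (auto simp: coeff a_def)
  have "poly (map_poly to_fract q) x = (\<Sum>i\<le>Suc n. to_fract (a i) * x ^ i)"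
    by (subst poly_altdef, subst degree_map_poly) (auto simp: deg coeff coeff_map_poly)
  also have "\<dots> = (\<Sum>i\<le>n. - (to_fract (c i) * x ^ i)) + x ^ Suc n"
    unfolding sum.atMost_Suc by (intro arg_cong2[where f = "(+)"] sum.cong) (auto simp: a_def)
  also have "\<dots> = 0" by (simp only: eq sum_negf) simp
  finally have "x \<in> range to_fract"
    using D deg coeff unfolding dedekind_domain_def a_def by metis
  then obtain y where "x = to_fract y" by blast
  then have "\<alpha> * y = \<beta>" using ax by (metis to_fract_mult to_fract_eq_iff)
  then show ?thesis by auto
qed

text \<open>Every nonzero prime is an associated prime of \<open>D/(\<alpha>)\<close>, for any nonzero \<open>\<alpha>\<close> in it.\<close>

lemma dedekind_domain_prime_colon:
  assumes D: "dedekind_domain TYPE('a::idom)"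
    and P: "primeideal P (class_ring :: 'a::idom ring)" "P \<noteq> {0}"
  obtains \<alpha> \<beta> :: "'a::idom" where "\<alpha> \<noteq> 0" "\<not> \<alpha> dvd \<beta>" "\<And>r. r \<in> P \<Longrightarrow> \<alpha> dvd r * \<beta>"
proof -
  let ?R = "class_ring :: 'a ring"
  interpret P: primeideal P ?R by fact
  note Pid = P.ideal_axioms[unfolded ideal_class_ring_iff]
  have one: "1 \<notin> P" using P.I_notcarr Pid by (auto simp: class_ring_simps) (metis mult.right_neutral)
  have prime: "u \<in> P \<or> v \<in> P" if "u * v \<in> P" for u v
    using P.I_prime[of u v] that by (simp add: class_ring_simps)
  obtain \<alpha> where \<alpha>: "\<alpha> \<in> P" "\<alpha> \<noteq> 0" using P(2) Pid by blast
  \<comment> \<open>\<open>C b\<close> is the annihilator of the class of \<open>b\<close> in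
    D/(\<alpha>). A maximal one among those inside \<open>P\<close> is sought; \<open>C 1\<close> is
    the ideal generated by \<open>\<alpha>\<close>, so there is one inside \<open>P\<close>.\<close>
  define C where "C b = {r. \<alpha> dvd r * b}" for b
  have C: "ideal (C b) ?R" for b
    unfolding ideal_class_ring_iff C_def by (auto simp: distrib_right mult.assoc)
  have in_family: "C 1 \<in> {I. \<exists>b. I = C b \<and> I \<subseteq> P}"
  proof -
    have "C 1 \<subseteq> P" using Pid \<alpha> by (auto simp: C_def mult.commute)
    then show ?thesis by blast
  qed
  obtain M where M: "M \<in> {I. \<exists>b. I = C b \<and> I \<subseteq> P}"
      "\<And>I. I \<in> {I. \<exists>b. I = C b \<and> I \<subseteq> P} \<Longrightarrow> M \<subseteq> I \<Longrightarrow> I = M"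
    by (rule noetherian_ring_maximal[of ?R "{I. \<exists>b. I = C b \<and> I \<subseteq> P}"])
      (use D C in_family in \<open>auto simp: dedekind_domain_def\<close>)
  then obtain b where b: "M = C b" "C b \<subseteq> P" by blast
  have max: "C b' = C b" if "C b' \<subseteq> P" "C b \<subseteq> C b'" for b'
    using M(2)[of "C b'"] that b by blast
  have C_mono: "C b \<subseteq> C (s * b)" for s b
    by (auto simp: C_def mult.left_commute[of _ s])
  have C_mult: "r \<in> C (s * b) \<longleftrightarrow> s * r \<in> C b" for r s b
    by (simp add: C_def mult_ac)
  \<comment> \<open>If \<open>v\<close> is not in \<open>C b\<close>, then \<open>C (u * b)\<close>
    is strictly larger than \<open>C b\<close> and by maximality contains some \<open>s\<close>
    outside \<open>P\<close>. Since \<open>P\<close> is prime, \<open>C (s * b)\<close> stays inside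
    \<open>P\<close>, so it equals \<open>C b\<close>; but it contains \<open>u\<close>.\<close>
  have prm: "v \<in> C b" if "u * v \<in> C b" "u \<notin> C b" for u v
  proof (rule ccontr)
    assume "v \<notin> C b"
    moreover have "v \<in> C (u * b)" using that C_mult by blast
    ultimately have "\<not> C (u * b) \<subseteq> P" using max C_mono by blast
    then obtain s where s: "s \<in> C (u * b)" "s \<notin> P" by blast
    have "C (s * b) \<subseteq> P" using C_mult b(2) prime s(2) by blast
    then have "C (s * b) = C b" using max C_mono by blast
    moreover have "u \<in> C (s * b)" using s(1) C_mult by (metis mult.commute)
    ultimately show False using that by blast
  qed
  have "primeideal (C b) ?R"
  proof (rule primeidealI)
    show "ideal (C b) ?R" "cring ?R" using C class_cring.cring_axioms by auto
    show "carrier ?R \<noteq> C b" using b(2) one by auto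
  qed (use prm in auto)
  \<comment> \<open>The prime \<open>C b\<close> is thus nonzero, hence maximal by the dimension
    condition, and being contained in \<open>P\<close> it equals \<open>P\<close>.\<close>
  moreover have "\<alpha> \<in> C b" by (simp add: C_def)
  ultimately have "maximalideal (C b) ?R"
    using D \<alpha>(2) unfolding dedekind_domain_def by blast
  then have "P = C b"
    using maximalideal.I_maximal[of "C b" ?R P] P.ideal_axioms b(2) P.I_notcarr by auto
  moreover have "\<not> \<alpha> dvd b" using one b(2) by (auto simp: C_def)
  ultimately show thesis using that \<alpha>(2) unfolding C_def by blast
qed

text \<open>An ideal that is maximal among those containing \<open>J\<close> but not
  \<open>1\<close> is a maximal ideal, hence prime.\<close>

lemma noetherian_ring_prime_exists:
  assumes N: "noetherian_ring (class_ring :: 'a::comm_ring_1 ring)"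
    and J: "ideal J (class_ring :: 'a::comm_ring_1 ring)" "1 \<notin> J"
  obtains P where "primeideal P class_ring" "J \<subseteq> P"
proof -
  let ?R = "class_ring :: 'a ring"
  obtain P where P: "P \<in> {I. ideal I ?R \<and> 1 \<notin> I \<and> J \<subseteq> I}"
      "\<And>I. I \<in> {I. ideal I ?R \<and> 1 \<notin> I \<and> J \<subseteq> I} \<Longrightarrow> P \<subseteq> I \<Longrightarrow> I = P"
    by (rule noetherian_ring_maximal[OF N, of "{I. ideal I ?R \<and> 1 \<notin> I \<and> J \<subseteq> I}"])
      (use J in auto)
  have "maximalideal P ?R"
  proof (rule maximalidealI)
    show "ideal P ?R" "carrier ?R \<noteq> P" using P(1) by auto
  next
    fix I assume I: "ideal I ?R" "P \<subseteq> I" "I \<subseteq> carrier ?R"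
    show "I = P \<or> I = carrier ?R"
    proof (cases "1 \<in> I")
      case True
      then have "x \<in> I" for x using I(1) unfolding ideal_class_ring_iff by (metis mult.right_neutral)
      then show ?thesis by auto
    next
      case False
      then show ?thesis using P I by blast
    qed
  qed
  then have "primeideal P ?R" using cring.maximalideal_prime class_cring.cring_axioms by blast
  then show thesis using that P(1) by blast
qed

text \<open>
  Invertibility of \<open>I\<close> without denominators: with \<open>N = a I\<^sup>-\<^sup>1\<close>, the
  conclusion says that \<open>a\<close> lies in the product ideal \<open>N I\<close>.
  Otherwise \<open>I I\<^sup>-\<^sup>1\<close> is contained in a prime \<open>P\<close>; an element \<open>q\<close> of \<open>P\<^sup>-\<^sup>1\<close> outside \<open>D\<close> maps
  \<open>I\<^sup>-\<^sup>1\<close> into itself, hence is integral over \<open>D\<close>.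
\<close>

lemma dedekind_domain_ideal_invertible:
  fixes a :: "'a::idom"
  assumes D: "dedekind_domain TYPE('a)"
    and I: "ideal I (class_ring :: 'a ring)" "a \<in> I" "a \<noteq> 0"
    and T: "ideal T (class_ring :: 'a ring)"
    and sub: "\<And>p y. y \<in> I \<Longrightarrow> (\<And>z. z \<in> I \<Longrightarrow> a dvd p * z) \<Longrightarrow> p * y \<in> T"
  shows "a \<in> T"
proof (rule ccontr)
  assume "a \<notin> T"
  \<comment> \<open>\<open>J\<close> is the ideal T/a without denominators; it is proper exactly
    because \<open>a\<close> is not in \<open>T\<close>.\<close>
  define J where "J = {c. a * c \<in> T}"
  have "ideal J class_ring"
    using T unfolding ideal_class_ring_iff J_def by (auto simp: distrib_left mult.left_commute)
  moreover have "1 \<notin> J" using \<open>a \<notin> T\<close> by (simp add: J_def)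
  ultimately obtain P where P: "primeideal P class_ring" "J \<subseteq> P"
    using noetherian_ring_prime_exists D unfolding dedekind_domain_def by blast
  have "a \<in> J" using sub[OF I(2), of a] by (simp add: J_def)
  then have "P \<noteq> {0}" using P(2) I(3) by blast
  then obtain \<alpha> \<beta> where \<alpha>: "\<alpha> \<noteq> 0" "\<not> \<alpha> dvd \<beta>" "\<And>r. r \<in> P \<Longrightarrow> \<alpha> dvd r * \<beta>"
    using dedekind_domain_prime_colon[OF D P(1)] by blast
  define N where "N = {p. \<forall>z\<in>I. a dvd p * z}"
  \<comment> \<open>Multiplication by \<beta>/\<alpha> preserves \<open>N\<close>: for
    \<open>p\<close> in \<open>N\<close> the quotients \<open>p * z / a\<close> with
    \<open>z\<close> in \<open>I\<close> lie in \<open>J\<close>, hence in \<open>P\<close>, and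
    \<beta>/\<alpha> maps \<open>P\<close> into D.\<close>
  have step: "\<exists>p'\<in>N. \<alpha> * p' = \<beta> * p" if p: "p \<in> N" for p
  proof -
    have in_P: "c \<in> P" if "y \<in> I" "p * y = a * c" for y c
      using sub[of y p] p that P(2) unfolding N_def J_def by auto
    have "p \<in> P" using in_P[of a p] I(2) by (simp add: mult.commute)
    then obtain p' where p': "p * \<beta> = \<alpha> * p'" using \<alpha>(3) by blast
    have "a dvd p' * z" if z: "z \<in> I" for z
    proof -
      obtain c where c: "p * z = a * c" using p z unfolding N_def by blast
      then obtain k where k: "c * \<beta> = \<alpha> * k" using \<alpha>(3) in_P z by blast
      have "\<alpha> * (p' * z) = \<beta> * (p * z)" using p' by (simp add: algebra_simps)
      also have "\<dots> = \<alpha> * (a * k)" using c k by (simp add: algebra_simps)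
      finally show ?thesis using \<alpha>(1) by simp
    qed
    then have "p' \<in> N" unfolding N_def by blast
    then show ?thesis using p' by (metis mult.commute)
  qed
  have "a \<in> N" by (simp add: N_def)
  \<comment> \<open>Iterating from \<open>a\<close> puts all products of \<open>a\<close> with
    powers of \<beta>/\<alpha> into D, the situation of \<open>dedekind_domain_dvd\<close>.\<close>
  then have "\<exists>f. \<forall>n. (f n \<in> N \<and> (n = 0 \<longrightarrow> f n = a)) \<and> \<alpha> * f (Suc n) = \<beta> * f n"
    by (intro dependent_nat_choice) (use step in blast)+
  then obtain f where "f 0 = a" "\<And>n. \<alpha> * f (Suc n) = \<beta> * f n" by blast
  then have "\<alpha> dvd \<beta>" using dedekind_domain_dvd[OF D \<alpha>(1), of f] I(3) by blast
  then show False using \<alpha>(2) by blast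
qed

lemma not_field_nonunit:
  assumes "\<not> field (class_ring :: 'a::comm_ring_1 ring)" "(0::'a) \<noteq> 1"
  obtains d :: "'a::comm_ring_1" where "d \<noteq> 0" "\<not> d dvd 1"
proof -
  have "\<exists>d::'a. d \<noteq> 0 \<and> \<not> d dvd 1"
  proof (rule ccontr)
    assume "\<not> ?thesis"
    then have unit: "\<exists>e. 1 = d * e" if "d \<noteq> 0" for d :: 'a
      using that by blast
    have "Units (class_ring :: 'a ring) = carrier class_ring - {\<zero>\<^bsub>class_ring\<^esub>}"
      unfolding Units_def using unit assms(2) by (auto simp: mult.commute)
    then show False
      using assms(1) cring.cring_fieldI[OF class_cring.cring_axioms] by blast
  qed
  then show thesis using that by blast
qed

section \<open>Torsion and direct summands\<close>

locale idom_module = Modules.module scale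
  for scale :: "'a::idom \<Rightarrow> 'b::ab_group_add \<Rightarrow> 'b"
begin

abbreviation torsion :: "'b set" where "torsion \<equiv> torsion_submodule scale"

text \<open>The elementary substitute for rank at most one; \<open>module_rank_le_one_iff\<close>
  gives the equivalence for finitely generated modules.\<close>

definition pairwise_dependent :: bool where
  "pairwise_dependent \<longleftrightarrow> (\<forall>x y. \<exists>a b. (a \<noteq> 0 \<or> b \<noteq> 0) \<and> scale a x + scale b y = 0)"

lemma torsionI: "d \<noteq> 0 \<Longrightarrow> scale d x = 0 \<Longrightarrow> x \<in> torsion"
  unfolding torsion_submodule_def by blast

lemma torsionE:
  assumes "x \<in> torsion" obtains d where "d \<noteq> 0" "scale d x = 0"
  using assms unfolding torsion_submodule_def by blast

lemma subspace_torsion: "subspace torsion"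
proof (rule subspaceI)
  show "0 \<in> torsion" by (rule torsionI[of 1]) auto
next
  fix x y assume "x \<in> torsion" "y \<in> torsion"
  then obtain d e where de: "d \<noteq> 0" "e \<noteq> 0" "scale d x = 0" "scale e y = 0"
    by (elim torsionE)
  have "scale (d * e) (x + y) = scale e (scale d x) + scale d (scale e y)"
    by (simp add: scale_right_distrib mult.commute)
  then show "x + y \<in> torsion" using de by (intro torsionI[of "d * e"]) auto
next
  fix c x assume "x \<in> torsion"
  then obtain d where "d \<noteq> 0" "scale d x = 0" by (rule torsionE)
  moreover have "scale d (scale c x) = scale c (scale d x)" by (simp add: mult.commute)
  ultimately show "scale c x \<in> torsion" by (intro torsionI[of d]) auto
qed

text \<open>The quotient by the torsion is torsion-free: if \<open>e\<close> annihilates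
  \<open>scale d x\<close>, then \<open>e * d\<close> is nonzero in a domain and annihilates
  \<open>x\<close>.\<close>

lemma scale_mem_torsion_iff: "d \<noteq> 0 \<Longrightarrow> scale d x \<in> torsion \<longleftrightarrow> x \<in> torsion"
proof
  assume d: "d \<noteq> 0" and "scale d x \<in> torsion"
  then obtain e where "e \<noteq> 0" "scale e (scale d x) = 0" by (elim torsionE)
  then show "x \<in> torsion" using d by (intro torsionI[of "e * d"]) auto
qed (rule subspace_scale[OF subspace_torsion])

lemma subspace_plus:
  assumes "subspace A" "subspace B" shows "subspace {a + b | a b. a \<in> A \<and> b \<in> B}"
proof -
  have "{a + b | a b. a \<in> A \<and> b \<in> B} = span (A \<union> B)"
    unfolding span_Un using assms by (simp only: span_eq_iff[THEN iffD2])
  then show ?thesis by simp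
qed

lemma internal_direct_sumI:
  assumes "subspace A" "subspace B" "A \<inter> B \<subseteq> {0}"
    and "\<And>x. x \<in> N \<longleftrightarrow> (\<exists>a\<in>A. \<exists>b\<in>B. x = a + b)"
  shows "internal_direct_sum scale N A B"
proof -
  have "0 \<in> A" "0 \<in> B" using assms(1,2) by (simp_all add: subspace_0)
  then show ?thesis unfolding internal_direct_sum_def using assms by blast
qed

lemma
  assumes "internal_direct_sum scale N A B"
  shows internal_direct_sum_subspace1: "subspace A"
    and internal_direct_sum_subspace2: "subspace B"
    and internal_direct_sum_Int: "x \<in> A \<Longrightarrow> x \<in> B \<Longrightarrow> x = 0"
    and internal_direct_sum_subset1: "A \<subseteq> N"
    and internal_direct_sum_subset2: "B \<subseteq> N"
    and internal_direct_sum_plus: "a \<in> A \<Longrightarrow> b \<in> B \<Longrightarrow> a + b \<in> N"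
proof -
  show sub: "subspace A" "subspace B"
    and "x \<in> A \<Longrightarrow> x \<in> B \<Longrightarrow> x = 0"
    and plus: "a \<in> A \<Longrightarrow> b \<in> B \<Longrightarrow> a + b \<in> N" for x a b
    using assms unfolding internal_direct_sum_def by auto
  show "A \<subseteq> N" "B \<subseteq> N"
    using plus[OF _ subspace_0[OF sub(2)]] plus[OF subspace_0[OF sub(1)]] by auto
qed

lemma internal_direct_sumE:
  assumes "internal_direct_sum scale N A B" "x \<in> N"
  obtains a b where "a \<in> A" "b \<in> B" "x = a + b"
  using assms unfolding internal_direct_sum_def by auto

lemmas internal_direct_sumD = internal_direct_sum_subspace1 internal_direct_sum_subspace2

lemma direct_summand_zero: "subspace A \<Longrightarrow> direct_summand scale {0} A"
  unfolding direct_summand_def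
  by (rule exI[of _ A], rule internal_direct_sumI) (auto simp: subspace_single_0)

text \<open>If \<open>A'\<close> complements \<open>A\<close> in \<open>B\<close> and
  \<open>B'\<close> complements \<open>B\<close> in \<open>C\<close>, then \<open>A' + B'\<close>
  complements \<open>A\<close> in \<open>C\<close>.\<close>

lemma direct_summand_trans:
  assumes "direct_summand scale A B" "direct_summand scale B C"
  shows "direct_summand scale A C"
proof -
  obtain A' B' where A': "internal_direct_sum scale B A A'" and B': "internal_direct_sum scale C B B'"
    using assms unfolding direct_summand_def by blast
  note [simp] = internal_direct_sumD[OF A'] internal_direct_sumD[OF B']
  have AB: "x \<in> B" if "x \<in> A \<or> x \<in> A'" for x
    using that internal_direct_sum_subset1[OF A'] internal_direct_sum_subset2[OF A'] by auto
  have "internal_direct_sum scale C A {a + b | a b. a \<in> A' \<and> b \<in> B'}"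
  proof (rule internal_direct_sumI)
    show "A \<inter> {a + b | a b. a \<in> A' \<and> b \<in> B'} \<subseteq> {0}"
    proof
      fix x assume "x \<in> A \<inter> {a + b | a b. a \<in> A' \<and> b \<in> B'}"
      then obtain a b where x: "x \<in> A" "x = a + b" "a \<in> A'" "b \<in> B'" by auto
      have "x - a \<in> B" by (rule subspace_diff) (use x AB in auto)
      then have "b = 0" using x internal_direct_sum_Int[OF B'] by simp
      then show "x \<in> {0}" using x internal_direct_sum_Int[OF A'] by simp
    qed
    show "x \<in> C \<longleftrightarrow> (\<exists>a\<in>A. \<exists>b\<in>{a + b | a b. a \<in> A' \<and> b \<in> B'}. x = a + b)" for x
    proof
      assume "x \<in> C"
      then obtain b b' where b: "b \<in> B" "b' \<in> B'" "x = b + b'"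
        by (rule internal_direct_sumE[OF B'])
      from b(1) obtain a a' where a: "a \<in> A" "a' \<in> A'" "b = a + a'"
        by (rule internal_direct_sumE[OF A'])
      have "x = a + (a' + b')" using a b by (simp add: add.assoc)
      then show "\<exists>a\<in>A. \<exists>b\<in>{a + b | a b. a \<in> A' \<and> b \<in> B'}. x = a + b"
        using a(1,2) b(2) by blast
    next
      assume "\<exists>a\<in>A. \<exists>b\<in>{a + b | a b. a \<in> A' \<and> b \<in> B'}. x = a + b"
      then obtain a a' b' where x: "a \<in> A" "a' \<in> A'" "b' \<in> B'" "x = (a + a') + b'"
        by (auto simp: add.assoc)
      show "x \<in> C"
        unfolding x(4) using x(1-3) by (intro internal_direct_sum_plus[OF B'] internal_direct_sum_plus[OF A'])
    qed
  qed (simp_all add: subspace_plus)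
  then show ?thesis unfolding direct_summand_def by blast
qed

section \<open>The torsion part of a submodule as a direct summand\<close>

text \<open>
  Fixing \<open>x\<close> outside the torsion, a common denominator \<open>d\<close> of the generators gives
  \<open>d m \<equiv> \<phi>(m) x\<close> modulo torsion for all \<open>m\<close>.
\<close>

lemma torsion_eq_kernel:
  assumes "pairwise_dependent" "finitely_generated_module scale"
  obtains \<phi> where "\<And>x y. \<phi> (x + y) = \<phi> x + \<phi> y" "\<And>c x. \<phi> (scale c x) = c * \<phi> x"
    "\<And>x. \<phi> x = 0 \<longleftrightarrow> x \<in> torsion"
proof (cases "torsion = UNIV")
  case True
  then show thesis using that[of "\<lambda>_. 0"] by simp
next
  case False
  then obtain x where x: "x \<notin> torsion" by blast
  \<comment> \<open>Modulo torsion, \<open>m\<close> has coordinate c/d along \<open>x\<close>. For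
    fixed \<open>d\<close> the value \<open>c\<close> is unique, as \<open>x\<close> is not torsion,
    and uniqueness later makes \<open>\<phi>\<close> linear.\<close>
  define Q where "Q d m c \<longleftrightarrow> scale d m - scale c x \<in> torsion" for d m c
  have Q_add: "Q d (m + m') (c + c')" if "Q d m c" "Q d m' c'" for d m m' c c'
    using subspace_add[OF subspace_torsion that[unfolded Q_def]]
    by (simp add: Q_def scale_right_distrib scale_left_distrib algebra_simps)
  have Q_scale: "Q d (scale r m) (r * c)" if "Q d m c" for d m r c
    using subspace_scale[OF subspace_torsion that[unfolded Q_def], of r]
    by (simp add: Q_def scale_right_diff_distrib mult.commute)
  have Q_mult: "Q (r * d) m (r * c)" if "Q d m c" for d m r c
    using subspace_scale[OF subspace_torsion that[unfolded Q_def], of r]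
    by (simp add: Q_def scale_right_diff_distrib)
  have Q_unique: "c = c'" if "Q d m c" "Q d m c'" for d m c c'
  proof -
    have "(scale d m - scale c x) - (scale d m - scale c' x) \<in> torsion"
      using that subspace_diff[OF subspace_torsion] unfolding Q_def by blast
    then have "scale (c' - c) x \<in> torsion" by (simp add: scale_left_diff_distrib)
    then show ?thesis using x scale_mem_torsion_iff[of "c' - c" x] by auto
  qed
  have Q_exists: "\<exists>d c. d \<noteq> 0 \<and> Q d m c" for m
  proof -
    obtain a b where ab: "a \<noteq> 0 \<or> b \<noteq> 0" "scale a m + scale b x = 0"
      using assms(1) unfolding pairwise_dependent_def by blast
    then have "a \<noteq> 0" using x torsionI[of b x] by auto
    moreover have "Q a m (- b)"
      unfolding Q_def using ab subspace_0[OF subspace_torsion] by simp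
    ultimately show ?thesis by blast
  qed
  obtain S where S: "finite S" "span S = UNIV"
    using assms(2) unfolding finitely_generated_module_def by blast
  from S(1) have "\<exists>d. d \<noteq> 0 \<and> (\<forall>m\<in>S. \<exists>c. Q d m c)"
  proof (induction S)
    case empty
    show ?case by (rule exI[of _ 1]) auto
  next
    case (insert m S)
    then obtain d where d: "d \<noteq> 0" "\<forall>m\<in>S. \<exists>c. Q d m c" by blast
    obtain e c where e: "e \<noteq> 0" "Q e m c" using Q_exists by blast
    have "\<exists>c. Q (e * d) m' c" if "m' \<in> insert m S" for m'
      using that d(2) e(2) Q_mult by (metis insertE mult.commute)
    then show ?case using d(1) e(1) by (intro exI[of _ "e * d"]) auto
  qed
  then obtain d where d: "d \<noteq> 0" "\<And>m. m \<in> S \<Longrightarrow> \<exists>c. Q d m c" by blast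
  have ex: "\<exists>c. Q d m c" for m
  proof -
    have "m \<in> span S" using S(2) by simp
    then show ?thesis
    proof (induction m rule: span_induct_alt)
      case base
      show ?case by (rule exI[of _ 0]) (simp add: Q_def subspace_0 subspace_torsion)
    next
      case (step c m m')
      then show ?case using d(2) Q_add Q_scale by metis
    qed
  qed
  define \<phi> where "\<phi> m = (THE c. Q d m c)" for m
  have \<phi>: "Q d m (\<phi> m)" for m
    unfolding \<phi>_def using ex Q_unique by (metis theI)
  show thesis
  proof (rule that[of \<phi>])
    show "\<phi> (x + y) = \<phi> x + \<phi> y" for x y using \<phi> Q_add Q_unique by metis
    show "\<phi> (scale c x) = c * \<phi> x" for c x using \<phi> Q_scale Q_unique by metis
    show "\<phi> m = 0 \<longleftrightarrow> m \<in> torsion" for m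
    proof -
      have "\<phi> m = 0 \<longleftrightarrow> Q d m 0" using \<phi> Q_unique by metis
      then show ?thesis by (simp add: Q_def scale_mem_torsion_iff d(1))
    qed
  qed
qed

text \<open>\<open>\<phi>\<close> induces an isomorphism from the quotient of \<open>B\<close> by
  its torsion onto the ideal \<open>I\<close>. If \<open>I\<close> is nonzero, its invertibility
  yields a linear section of \<open>\<phi>\<close> over \<open>I\<close>, and the image of the
  section is a complement.\<close>

lemma torsion_direct_summand:
  assumes D: "dedekind_domain TYPE('a)"
    and add: "\<And>x y. \<phi> (x + y) = \<phi> x + \<phi> y" and mult: "\<And>c x. \<phi> (scale c x) = c * \<phi> x"
    and ker: "\<And>x. \<phi> x = 0 \<longleftrightarrow> x \<in> torsion"
    and B: "subspace B"
  shows "direct_summand scale (B \<inter> torsion) B"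
proof (cases "B \<subseteq> torsion")
  case True
  have "internal_direct_sum scale B B {0}"
    using B by (intro internal_direct_sumI) (auto simp: subspace_single_0)
  then show ?thesis using True unfolding direct_summand_def by (auto simp: Int_absorb2)
next
  case False
  have \<phi>0: "\<phi> 0 = 0" by (simp add: ker subspace_0 subspace_torsion)
  define I where "I = \<phi> ` B"
  have I: "ideal I class_ring"
    unfolding ideal_class_ring_iff
  proof (intro conjI ballI allI)
    show "0 \<in> I" unfolding I_def using \<phi>0 B subspace_0 by (metis image_eqI)
  next
    fix x y assume "x \<in> I" "y \<in> I"
    then show "x + y \<in> I" unfolding I_def
      by (auto simp flip: add intro: imageI subspace_add[OF B])
  next
    fix c x assume "x \<in> I"
    then show "c * x \<in> I" unfolding I_def
      by (auto simp flip: mult intro: imageI subspace_scale[OF B])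
  qed
  note I' = I[unfolded ideal_class_ring_iff]
  obtain a where a: "a \<in> I" "a \<noteq> 0" using False ker unfolding I_def by blast
  define lin where "lin \<sigma> \<longleftrightarrow> \<sigma> \<in> I \<rightarrow> B \<and> (\<forall>y\<in>I. \<forall>z\<in>I. \<sigma> (y + z) = \<sigma> y + \<sigma> z) \<and>
    (\<forall>c. \<forall>z\<in>I. \<sigma> (c * z) = scale c (\<sigma> z))" for \<sigma>
  \<comment> \<open>Multiplication by \<open>c/a\<close> on \<open>I\<close> lifts along \<open>\<phi>\<close> to a map from \<open>I\<close> to \<open>B\<close>.\<close>
  define T where "T = {c. \<exists>\<sigma>. lin \<sigma> \<and> (\<forall>z\<in>I. a * \<phi> (\<sigma> z) = c * z)}"
  have "ideal T class_ring"
    unfolding ideal_class_ring_iff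
  proof (intro conjI ballI allI)
    have "lin (\<lambda>_. 0)" using B by (simp add: lin_def subspace_0)
    then show "0 \<in> T" unfolding T_def using \<phi>0 by (intro CollectI exI[of _ "\<lambda>_. 0"]) simp
  next
    fix c d assume "c \<in> T" "d \<in> T"
    then obtain \<sigma> \<rho> where "lin \<sigma>" "lin \<rho>"
      "\<forall>z\<in>I. a * \<phi> (\<sigma> z) = c * z" "\<forall>z\<in>I. a * \<phi> (\<rho> z) = d * z"
      unfolding T_def by blast
    moreover from this have "lin (\<lambda>z. \<sigma> z + \<rho> z)"
      unfolding lin_def by (auto simp: scale_right_distrib intro!: subspace_add[OF B])
    ultimately show "c + d \<in> T"
      unfolding T_def by (intro CollectI exI[of _ "\<lambda>z. \<sigma> z + \<rho> z"]) (simp add: add distrib_left distrib_right)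
  next
    fix r c assume "c \<in> T"
    then obtain \<sigma> where "lin \<sigma>" "\<forall>z\<in>I. a * \<phi> (\<sigma> z) = c * z"
      unfolding T_def by blast
    moreover from this have "lin (\<lambda>z. scale r (\<sigma> z))"
      unfolding lin_def
      by (auto simp: scale_right_distrib mult.commute intro!: subspace_scale[OF B])
    ultimately show "r * c \<in> T"
      unfolding T_def
      by (intro CollectI exI[of _ "\<lambda>z. scale r (\<sigma> z)"]) (simp add: mult mult.left_commute mult.assoc)
  qed
  \<comment> \<open>With \<open>b\<close> in \<open>B\<close> over \<open>y\<close>, the required
    lift sends \<open>z\<close> to (p z / a) \<open>b\<close>; the quotient is
    \<open>g z\<close>.\<close>
  moreover have "p * y \<in> T" if y: "y \<in> I" and p: "\<And>z. z \<in> I \<Longrightarrow> a dvd p * z" for p y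
  proof -
    obtain b where b: "b \<in> B" "\<phi> b = y" using y unfolding I_def by blast
    define g where "g z = (SOME g. p * z = a * g)" for z
    have g: "p * z = a * g z" if "z \<in> I" for z
      unfolding g_def using p[OF that] unfolding dvd_def by (rule someI_ex)
    have g_unique: "g z = u" if "z \<in> I" "p * z = a * u" for z u
      using g[OF that(1)] that(2) a(2) by auto
    have "g (y + z) = g y + g z" if "y \<in> I" "z \<in> I" for y z
      using I' that by (intro g_unique) (auto simp: distrib_left g)
    moreover have "g (c * z) = c * g z" if "z \<in> I" for c z
      using I' that by (intro g_unique) (auto simp: mult.left_commute g)
    ultimately have "lin (\<lambda>z. scale (g z) b)"
      using b(1) subspace_scale[OF B] unfolding lin_def by (auto simp: scale_left_distrib)
    moreover have "a * \<phi> (scale (g z) b) = p * y * z" if "z \<in> I" for z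
    proof -
      have "a * \<phi> (scale (g z) b) = a * g z * y" by (simp add: mult b(2) mult.assoc)
      also have "\<dots> = p * z * y" by (simp only: g[OF that])
      finally show ?thesis by (simp add: mult_ac)
    qed
    ultimately show ?thesis unfolding T_def by blast
  qed
  ultimately have "a \<in> T"
    by (rule dedekind_domain_ideal_invertible[OF D I a])
  \<comment> \<open>Membership of \<open>a\<close> itself in \<open>T\<close> lifts multiplication
    by a/a = 1, which is a section.\<close>
  then obtain \<sigma> where \<sigma>: "lin \<sigma>" "\<And>z. z \<in> I \<Longrightarrow> \<phi> (\<sigma> z) = z"
    using a(2) unfolding T_def by auto
  have in_I: "\<phi> x \<in> I" if "x \<in> B" for x using that by (simp add: I_def)
  have in_B: "\<sigma> z \<in> B" if "z \<in> I" for z using that \<sigma>(1) unfolding lin_def by blast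
  have \<sigma>0: "\<sigma> 0 = 0"
  proof -
    have "\<sigma> (0 * a) = scale 0 (\<sigma> a)" using \<sigma>(1) a(1) unfolding lin_def by blast
    then show ?thesis by simp
  qed
  \<comment> \<open>This is the image of the section, described as the fixed points of the
    projection.\<close>
  define C where "C = {x \<in> B. \<sigma> (\<phi> x) = x}"
  have "internal_direct_sum scale B (B \<inter> torsion) C"
  proof (rule internal_direct_sumI)
    show "subspace (B \<inter> torsion)" using B subspace_torsion by (rule subspace_inter)
    show "subspace C"
      using B \<phi>0 \<sigma>0 \<sigma>(1) in_I unfolding C_def lin_def
      by (intro subspaceI) (auto simp: add mult intro: subspace_0 subspace_add subspace_scale)
    show "B \<inter> torsion \<inter> C \<subseteq> {0}"
      using \<sigma>0 by (auto simp: C_def simp flip: ker)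
    show "x \<in> B \<longleftrightarrow> (\<exists>t\<in>B \<inter> torsion. \<exists>c\<in>C. x = t + c)" for x
    proof
      assume x: "x \<in> B"
      define c where "c = \<sigma> (\<phi> x)"
      have "\<phi> c = \<phi> x" unfolding c_def using \<sigma>(2) in_I x by blast
      moreover have "\<phi> x = \<phi> (x - c) + \<phi> c" by (simp flip: add)
      ultimately have "x - c \<in> torsion" using ker by auto
      moreover have "c \<in> C" "x - c \<in> B"
        using \<open>\<phi> c = \<phi> x\<close> in_B in_I x subspace_diff[OF B] by (auto simp: C_def c_def)
      ultimately show "\<exists>t\<in>B \<inter> torsion. \<exists>c\<in>C. x = t + c"
        by (intro bexI[of _ "x - c"] bexI[of _ c]) auto
    qed (auto simp: C_def intro: subspace_add[OF B])
  qed
  then show ?thesis unfolding direct_summand_def by blast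
qed

section \<open>Linear dependence forced by C4\<close>

lemma C4_star_imp_pairwise_dependent:
  assumes C4: "C4_star_module scale UNIV" and nf: "\<not> field (class_ring :: 'a ring)"
  shows "pairwise_dependent"
  unfolding pairwise_dependent_def
proof (rule ccontr)
  assume "\<not> (\<forall>x y. \<exists>a b. (a \<noteq> 0 \<or> b \<noteq> 0) \<and> scale a x + scale b y = 0)"
  then obtain x y where indep: "\<And>a b. scale a x + scale b y = 0 \<Longrightarrow> a = 0 \<and> b = 0" by blast
  have x: "a = b" if "scale a x = scale b x" for a b
    using indep[of "a - b" 0] that by (simp add: scale_left_diff_distrib)
  have y: "a = b" if "scale a y = scale b y" for a b
    using indep[of 0 "a - b"] that by (simp add: scale_left_diff_distrib)
  obtain d :: 'a where d: "d \<noteq> 0" "\<not> d dvd 1" using not_field_nonunit[OF nf] by auto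
  define A B where "A = range (\<lambda>r. scale r x)" and "B = range (\<lambda>r. scale r y)"
  have sub: "subspace A" "subspace B"
    unfolding A_def B_def span_singleton[symmetric] by (rule subspace_span)+
  have ids: "internal_direct_sum scale {a + b | a b. a \<in> A \<and> b \<in> B} A B"
  proof (rule internal_direct_sumI)
    show "A \<inter> B \<subseteq> {0}"
    proof
      fix z assume "z \<in> A \<inter> B"
      then obtain r s where rs: "z = scale r x" "z = scale s y" unfolding A_def B_def by blast
      then show "z \<in> {0}" using indep[of r "- s"] by auto
    qed
  qed (use sub in auto)
  \<comment> \<open>The coefficient \<open>r\<close> is determined by \<open>z\<close> because
    \<open>x\<close> generates a free module.\<close>
  define f where "f z = scale (d * (THE r. z = scale r x)) y" for z
  have f: "f (scale r x) = scale (d * r) y" for r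
  proof -
    have "(THE s. scale r x = scale s x) = r" using x by auto
    then show ?thesis by (simp add: f_def)
  qed
  have "submodule_hom scale A B f"
    unfolding submodule_hom_def
  proof (intro conjI ballI allI)
    show "f \<in> A \<rightarrow> B" unfolding A_def B_def using f by auto
  next
    fix u v assume "u \<in> A" "v \<in> A"
    then obtain r s where "u = scale r x" "v = scale s x" unfolding A_def by blast
    then show "f (u + v) = f u + f v"
      by (simp add: f distrib_left scale_left_distrib[of _ _ y] flip: scale_left_distrib[of r s x])
  next
    fix c u assume "u \<in> A"
    then obtain r where "u = scale r x" unfolding A_def by blast
    then show "f (scale c u) = scale c (f u)" by (simp add: f mult.left_commute)
  qed
  moreover have "{z \<in> A. f z = 0} = {0}"
  proof -
    have "scale r x = 0" if "f (scale r x) = 0" for r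
      using y[of "d * r" 0] that d(1) by (simp add: f)
    moreover have "f 0 = 0" using f[of 0] by simp
    ultimately show ?thesis using subspace_0[OF sub(1)] by (auto simp: A_def)
  qed
  moreover have "C4_module scale {a + b | a b. a \<in> A \<and> b \<in> B}"
    using C4 subspace_plus[OF sub] unfolding C4_star_module_def by blast
  ultimately have "direct_summand scale (f ` A) B"
    using ids direct_summand_zero[OF sub(1)] unfolding C4_module_def by auto
  then obtain C where C: "internal_direct_sum scale B (f ` A) C"
    unfolding direct_summand_def by blast
  \<comment> \<open>The image of \<open>f\<close> is \<open>d B\<close>, so \<open>scale d c\<close>
    lies in both summands and vanishes; \<open>B\<close> is free on \<open>y\<close>, so
    \<open>c\<close> vanishes too. Hence \<open>B = d B\<close>, which makes \<open>d\<close> a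
    unit.\<close>
  have C0: "c = 0" if c: "c \<in> C" for c
  proof -
    have "c \<in> B" using c internal_direct_sum_subset2[OF C] by auto
    then obtain r where r: "c = scale r y" unfolding B_def by auto
    then have "scale d c = f (scale r x)" by (simp add: f)
    then have "scale d c \<in> f ` A" by (simp add: A_def)
    moreover have "scale d c \<in> C"
      using c internal_direct_sum_subspace2[OF C] by (simp add: subspace_scale)
    ultimately have "scale d c = 0" by (rule internal_direct_sum_Int[OF C])
    then show "c = 0" using r y[of "d * r" 0] d by simp
  qed
  have "y \<in> B" unfolding B_def by (auto intro: range_eqI[of _ _ 1])
  then obtain z c where "z \<in> f ` A" "c \<in> C" "y = z + c"
    by (rule internal_direct_sumE[OF C])
  then have "y \<in> f ` A" using C0 by force
  then obtain r where "scale 1 y = scale (d * r) y" using f by (auto simp: A_def)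
  then have "1 = d * r" by (rule y)
  then show False using d(2) by (metis dvdI)
qed

section \<open>Extension of C4 from the torsion submodule to the whole module\<close>

lemma C4_star_torsion_imp_C4_star:
  assumes D: "dedekind_domain TYPE('a)" and fg: "finitely_generated_module scale"
    and dep: pairwise_dependent and C4: "C4_star_module scale torsion"
  shows "C4_star_module scale UNIV"
  unfolding C4_star_module_def C4_module_def
proof (intro allI impI)
  fix L A B f
  assume "internal_direct_sum scale L A B \<and> submodule_hom scale A B f \<and>
    direct_summand scale {x \<in> A. f x = 0} A"
  then obtain A' where ids: "internal_direct_sum scale L A B" and hom: "submodule_hom scale A B f"
    and ker: "internal_direct_sum scale A {x \<in> A. f x = 0} A'"
    unfolding direct_summand_def by blast
  note [simp] = internal_direct_sumD[OF ids] internal_direct_sumD[OF ker]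
  have f_B: "f x \<in> B" and f_add: "y \<in> A \<Longrightarrow> f (x + y) = f x + f y"
    and f_scale: "f (scale c x) = scale c (f x)" if "x \<in> A" for x y c
    using hom that unfolding submodule_hom_def by auto
  have f_0: "f 0 = 0" using f_scale[of 0 0] by (simp add: subspace_0)
  \<comment> \<open>The hypothesis on the torsion is applied to the submodule \<open>X + Y\<close>,
    so it serves any pair of independent torsion submodules.\<close>
  have torsion_C4: "direct_summand scale (g ` X) Y"
    if "subspace X" "subspace Y" "X \<inter> Y \<subseteq> {0}" "X \<subseteq> torsion" "Y \<subseteq> torsion"
      "submodule_hom scale X Y g" "direct_summand scale {x \<in> X. g x = 0} X" for X Y g
  proof -
    have "internal_direct_sum scale {a + b | a b. a \<in> X \<and> b \<in> Y} X Y"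
      using that by (intro internal_direct_sumI) auto
    moreover have "{a + b | a b. a \<in> X \<and> b \<in> Y} \<subseteq> torsion"
      using that subspace_add[OF subspace_torsion] by blast
    then have "C4_module scale {a + b | a b. a \<in> X \<and> b \<in> Y}"
      using C4 subspace_plus[OF that(1,2)] unfolding C4_star_module_def by blast
    ultimately show ?thesis using that(6,7) unfolding C4_module_def by blast
  qed
  consider "A \<subseteq> torsion" | "B \<subseteq> torsion"
  proof -
    \<comment> \<open>In a relation between \<open>a\<close> and \<open>b\<close> both terms lie in
      \<open>A \<inter> B\<close> and vanish. As \<open>b\<close> is not torsion,
      \<open>s = 0\<close>, so \<open>r\<close> is a nonzero annihilator of
      \<open>a\<close>.\<close>
    have "a \<in> torsion" if "b \<in> B" "b \<notin> torsion" "a \<in> A" for a b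
    proof -
      obtain r s where rs: "r \<noteq> 0 \<or> s \<noteq> 0" "scale r a + scale s b = 0"
        using dep unfolding pairwise_dependent_def by blast
      then have "scale r a = scale (- s) b" by (simp add: eq_neg_iff_add_eq_0)
      then have "scale r a \<in> B" using that by (simp only: subspace_scale internal_direct_sumD[OF ids])
      with that have "scale r a = 0"
        by (intro internal_direct_sum_Int[OF ids]) (simp_all add: subspace_scale)
      moreover from this have "scale s b = 0" using rs by simp
      ultimately show ?thesis using rs(1) that(2) torsionI by blast
    qed
    then show thesis using that by blast
  qed
  then show "direct_summand scale (f ` A) B"
  proof cases
    case 1
    obtain \<phi> where "\<And>x y. \<phi> (x + y) = \<phi> x + \<phi> y" "\<And>c x. \<phi> (scale c x) = c * \<phi> x"
      "\<And>x. \<phi> x = 0 \<longleftrightarrow> x \<in> torsion"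
      using torsion_eq_kernel[OF dep fg] by blast
    from torsion_direct_summand[OF D this] have "direct_summand scale (B \<inter> torsion) B"
      by simp
    moreover have "direct_summand scale (f ` A) (B \<inter> torsion)"
    proof (rule torsion_C4)
      have "f x \<in> torsion" if x: "x \<in> A" for x
      proof -
        obtain d where "d \<noteq> 0" "scale d x = 0" using subsetD[OF 1 x] by (rule torsionE)
        moreover from this have "scale d (f x) = 0" by (simp add: f_0 flip: f_scale[OF x])
        ultimately show ?thesis by (intro torsionI[of d])
      qed
      then show "submodule_hom scale A (B \<inter> torsion) f"
        using hom unfolding submodule_hom_def by auto
      show "direct_summand scale {x \<in> A. f x = 0} A"
        using ker unfolding direct_summand_def by auto
    qed (use 1 internal_direct_sum_Int[OF ids] in \<open>auto simp: subspace_inter subspace_torsion\<close>)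
    ultimately show ?thesis by (rule direct_summand_trans[rotated])
  next
    case 2
    have A'_A: "x \<in> A" if "x \<in> A'" for x
      using that internal_direct_sum_subset2[OF ker] by auto
    have "f ` A = f ` A'"
    proof
      show "f ` A \<subseteq> f ` A'"
      proof
        fix z assume "z \<in> f ` A"
        then obtain x where x: "x \<in> A" "z = f x" by auto
        from x(1) obtain k u where "k \<in> {x \<in> A. f x = 0}" "u \<in> A'" "x = k + u"
          by (rule internal_direct_sumE[OF ker])
        then show "z \<in> f ` A'" using x A'_A by (auto simp: f_add)
      qed
    qed (use A'_A in auto)
    moreover have "direct_summand scale (f ` A') B"
    proof (rule torsion_C4)
      show "A' \<subseteq> torsion"
      proof
        fix x assume x: "x \<in> A'"
        then have "f x \<in> torsion" using A'_A f_B 2 by auto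
        then obtain d where d: "d \<noteq> 0" "scale d (f x) = 0" by (rule torsionE)
        then have "f (scale d x) = 0" using x A'_A f_scale by simp
        then have "scale d x = 0"
          using x A'_A by (intro internal_direct_sum_Int[OF ker]) (simp_all add: subspace_scale)
        then show "x \<in> torsion" using d(1) by (intro torsionI)
      qed
      show "submodule_hom scale A' B f"
        using hom A'_A unfolding submodule_hom_def by auto
      have "{x \<in> A'. f x = 0} = {0}"
        using A'_A internal_direct_sum_Int[OF ker] by (auto simp: subspace_0 f_0)
      then show "direct_summand scale {x \<in> A'. f x = 0} A'"
        by (simp add: direct_summand_zero)
    qed (use A'_A 2 internal_direct_sum_Int[OF ids] in auto)
    ultimately show ?thesis by simp
  qed
qed

end

section \<open>Rank and linear dependence\<close>

lemma frag_induct [case_names zero of diff]: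
  assumes "P 0" "\<And>p. P (frag_of p)" "\<And>a b. P a \<Longrightarrow> P b \<Longrightarrow> P (a - b)"
  shows "P c"
  using subset_UNIV by (induction c rule: frag_induction) (use assms in auto)

context idom_module
begin

abbreviation ker_tensor :: "('a fract \<times> 'b \<Rightarrow>\<^sub>0 int) set" where
  "ker_tensor \<equiv> tensor_kernel scale"

lemma tensor_relations_subset: "tensor_relations scale \<subseteq> ker_tensor"
  unfolding tensor_kernel_def by (auto intro: generate.incl)

lemma
  shows tensor_kernel_0: "0 \<in> ker_tensor"
    and tensor_kernel_add: "x \<in> ker_tensor \<Longrightarrow> y \<in> ker_tensor \<Longrightarrow> x + y \<in> ker_tensor"
    and tensor_kernel_minus: "x \<in> ker_tensor \<Longrightarrow> - x \<in> ker_tensor"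
proof -
  have "subgroup ker_tensor free_pairs"
    unfolding tensor_kernel_def
    by (rule group.generate_is_subgroup[OF group_free_Abelian_group]) auto
  then show "0 \<in> ker_tensor" "x \<in> ker_tensor \<Longrightarrow> y \<in> ker_tensor \<Longrightarrow> x + y \<in> ker_tensor"
    "x \<in> ker_tensor \<Longrightarrow> - x \<in> ker_tensor"
    using subgroup.one_closed subgroup.m_closed subgroup.m_inv_closed by fastforce+
qed

lemma tensor_kernel_diff: "x \<in> ker_tensor \<Longrightarrow> y \<in> ker_tensor \<Longrightarrow> x - y \<in> ker_tensor"
  using tensor_kernel_add[OF _ tensor_kernel_minus] by simp

lemma tensor_kernel_induct [consumes 1, case_names zero minus add left right balanced]:
  assumes "c \<in> ker_tensor" and "P 0" and minus: "\<And>x. P x \<Longrightarrow> P (- x)"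
    and add: "\<And>x y. P x \<Longrightarrow> P y \<Longrightarrow> P (x + y)"
    and left: "\<And>k k' m. P (frag_of (k + k', m) - frag_of (k, m) - frag_of (k', m))"
    and right: "\<And>k m m'. P (frag_of (k, m + m') - frag_of (k, m) - frag_of (k, m'))"
    and balanced: "\<And>k d m. P (frag_of (k * to_fract d, m) - frag_of (k, scale d m))"
  shows "P c"
  using assms(1) unfolding tensor_kernel_def
proof (induction rule: generate.induct)
  case (incl h)
  then show ?case using left right balanced by (auto simp: tensor_relations_def)
next
  case (inv h)
  then have "P h" using left right balanced by (auto simp: tensor_relations_def)
  then show ?case using minus by simp
qed (use assms(2) add in auto)

text \<open>The element of K \<otimes> M represented by \<open>c\<close>;
  \<open>frag_of (k, m)\<close> represents the pure tensor k \<otimes> m. The form by differences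
  turns equality of cosets into membership in the kernel.\<close>

definition tensor_class :: "('a fract \<times> 'b \<Rightarrow>\<^sub>0 int) \<Rightarrow> ('a fract \<times> 'b \<Rightarrow>\<^sub>0 int) set" where
  "tensor_class c = {x. x - c \<in> ker_tensor}"

lemma tensor_class_eq_r_coset: "tensor_class c = ker_tensor #>\<^bsub>free_pairs\<^esub> c"
  unfolding tensor_class_def r_coset_def by (auto intro: bexI[of _ "x - c" for x])

lemma tensor_class_eq_iff: "tensor_class c = tensor_class d \<longleftrightarrow> c - d \<in> ker_tensor"
proof
  assume "tensor_class c = tensor_class d"
  moreover have "c \<in> tensor_class c" by (simp add: tensor_class_def tensor_kernel_0)
  ultimately show "c - d \<in> ker_tensor" by (simp add: tensor_class_def)
next
  assume *: "c - d \<in> ker_tensor"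
  have "x - c \<in> ker_tensor \<longleftrightarrow> x - d \<in> ker_tensor" for x
    using tensor_kernel_add[OF _ *, of "x - c"] tensor_kernel_diff[OF _ *, of "x - d"] by auto
  then show "tensor_class c = tensor_class d" by (simp add: tensor_class_def)
qed

lemma carrier_fract_tensor: "carrier (fract_tensor scale) = range tensor_class"
  by (auto simp: fract_tensor_def carrier_FactGroup tensor_class_eq_r_coset)

lemma zero_fract_tensor: "\<zero>\<^bsub>fract_tensor scale\<^esub> = tensor_class 0"
  by (simp add: fract_tensor_def tensor_class_def)

lemma add_fract_tensor:
  "tensor_class c \<oplus>\<^bsub>fract_tensor scale\<^esub> tensor_class d = tensor_class (c + d)"
proof -
  have "x \<in> tensor_class c <#>\<^bsub>free_pairs\<^esub> tensor_class d \<longleftrightarrow> x - (c + d) \<in> ker_tensor" for x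
  proof
    assume "x \<in> tensor_class c <#>\<^bsub>free_pairs\<^esub> tensor_class d"
    then obtain u v where "x = u + v" "u - c \<in> ker_tensor" "v - d \<in> ker_tensor"
      by (auto simp: set_mult_def tensor_class_def)
    then show "x - (c + d) \<in> ker_tensor"
      using tensor_kernel_add[of "u - c" "v - d"] by (simp add: algebra_simps)
  next
    assume "x - (c + d) \<in> ker_tensor"
    then have "x - c \<in> tensor_class d" by (simp add: tensor_class_def algebra_simps)
    moreover have "c \<in> tensor_class c" by (simp add: tensor_class_def tensor_kernel_0)
    ultimately show "x \<in> tensor_class c <#>\<^bsub>free_pairs\<^esub> tensor_class d"
      unfolding set_mult_def by force
  qed
  then show ?thesis by (auto simp: fract_tensor_def tensor_class_def)
qed

definition mult_left :: "'a fract \<Rightarrow> ('a fract \<times> 'b \<Rightarrow>\<^sub>0 int) \<Rightarrow> ('a fract \<times> 'b \<Rightarrow>\<^sub>0 int)" where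
  "mult_left k = frag_extend (\<lambda>(l, m). frag_of (k * l, m))"

lemma mult_left_simps [simp]:
  "mult_left k 0 = 0" "mult_left k (frag_of (l, m)) = frag_of (k * l, m)"
  "mult_left k (- c) = - mult_left k c"
  "mult_left k (c + d) = mult_left k c + mult_left k d"
  "mult_left k (c - d) = mult_left k c - mult_left k d"
  by (simp_all add: mult_left_def frag_extend_minus frag_extend_add frag_extend_diff)

lemma
  shows tensor_kernel_left: "frag_of (k + k', m) - frag_of (k, m) - frag_of (k', m) \<in> ker_tensor"
    and tensor_kernel_right: "frag_of (k, m + m') - frag_of (k, m) - frag_of (k, m') \<in> ker_tensor"
    and tensor_kernel_balanced: "frag_of (k * to_fract d, m) - frag_of (k, scale d m) \<in> ker_tensor"
  using tensor_relations_subset unfolding tensor_relations_def by blast+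

text \<open>Each defining relation is mapped to a relation of the same kind. This makes scalar
  multiplication well defined on cosets.\<close>

lemma mult_left_tensor_kernel: "c \<in> ker_tensor \<Longrightarrow> mult_left k c \<in> ker_tensor"
proof (induction rule: tensor_kernel_induct)
  case (left l l' m)
  then show ?case using tensor_kernel_left[of "k * l" "k * l'" m] by (simp add: distrib_left)
next
  case (right l m m')
  then show ?case using tensor_kernel_right by simp
next
  case (balanced l d m)
  then show ?case using tensor_kernel_balanced[of "k * l" d m] by (simp add: mult.assoc)
qed (simp_all add: tensor_kernel_0 tensor_kernel_minus tensor_kernel_add)

lemma smult_fract_tensor:
  "k \<odot>\<^bsub>fract_tensor scale\<^esub> tensor_class c = tensor_class (mult_left k c)"
proof -
  have "x \<in> ker_tensor <#>\<^bsub>free_pairs\<^esub> mult_left k ` tensor_class c \<longleftrightarrow> x - mult_left k c \<in> ker_tensor" for x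
  proof
    assume "x \<in> ker_tensor <#>\<^bsub>free_pairs\<^esub> mult_left k ` tensor_class c"
    then obtain u v where "x = u + mult_left k v" "u \<in> ker_tensor" "v - c \<in> ker_tensor"
      by (auto simp: set_mult_def tensor_class_def)
    then show "x - mult_left k c \<in> ker_tensor"
      using tensor_kernel_add[OF _ mult_left_tensor_kernel, of u "v - c" k] by (simp add: algebra_simps)
  next
    assume "x - mult_left k c \<in> ker_tensor"
    moreover have "c \<in> tensor_class c" by (simp add: tensor_class_def tensor_kernel_0)
    ultimately show "x \<in> ker_tensor <#>\<^bsub>free_pairs\<^esub> mult_left k ` tensor_class c"
      unfolding set_mult_def by force
  qed
  then show ?thesis by (auto simp: fract_tensor_def tensor_class_def mult_left_def)
qed

lemma mult_left_assoc: "mult_left (k * l) c = mult_left k (mult_left l c)"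
  by (induction c rule: frag_induct) (auto simp: mult.assoc)

lemma mult_left_one: "mult_left 1 c = c"
  by (induction c rule: frag_induct) auto

text \<open>On a generator the difference is a relation of additivity in the first factor, so this
  law is stated modulo the kernel, while \<open>mult_left_assoc\<close> is an equality in the free
  group.\<close>

lemma mult_left_distrib: "mult_left (k + l) c - (mult_left k c + mult_left l c) \<in> ker_tensor"
proof (induction c rule: frag_induct)
  case (of p)
  then show ?case
    using tensor_kernel_left[of "k * fst p" "l * fst p" "snd p"]
    by (cases p) (simp add: distrib_right algebra_simps)
next
  case (diff a b)
  then show ?case using tensor_kernel_diff by (fastforce simp: algebra_simps)
qed (simp add: tensor_kernel_0)

lemma vectorspace_fract_tensor: "vectorspace (class_ring :: 'a fract ring) (fract_tensor scale)"
proof (rule vectorspace.intro)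
  show "field (class_ring :: 'a fract ring)" by (rule class_field)
  have minus: "\<exists>d. tensor_class (c + d) = tensor_class 0" for c
    by (rule exI[of _ "- c"]) simp
  have "abelian_group (fract_tensor scale)"
    by (rule abelian_groupI)
      (auto simp: carrier_fract_tensor zero_fract_tensor add_fract_tensor add_ac minus)
  then show "Module.module (class_ring :: 'a fract ring) (fract_tensor scale)"
    by (intro moduleI class_cring.cring_axioms)
      (auto simp: carrier_fract_tensor zero_fract_tensor add_fract_tensor smult_fract_tensor
        mult_left_assoc mult_left_one mult_left_distrib[folded tensor_class_eq_iff])
qed

section \<open>Linear relations in M from vanishing tensors\<close>

text \<open>The additive extension of \<open>g\<close> from the basis to the free abelian group,
  with integers acting through D.\<close>

definition frag_sum :: "('c \<Rightarrow> 'b) \<Rightarrow> ('c \<Rightarrow>\<^sub>0 int) \<Rightarrow> 'b" where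
  "frag_sum g c = (\<Sum>p\<in>Poly_Mapping.keys c. scale (of_int (Poly_Mapping.lookup c p)) (g p))"

lemma frag_sum_superset:
  assumes "finite S" "Poly_Mapping.keys c \<subseteq> S"
  shows "frag_sum g c = (\<Sum>p\<in>S. scale (of_int (Poly_Mapping.lookup c p)) (g p))"
  unfolding frag_sum_def using assms by (intro sum.mono_neutral_left) (auto simp: in_keys_iff)

lemma frag_sum_simps [simp]:
  "frag_sum g 0 = 0" "frag_sum g (frag_of p) = g p"
  "frag_sum g (- c) = - frag_sum g c" "frag_sum g (c + d) = frag_sum g c + frag_sum g d"
  "frag_sum g (c - d) = frag_sum g c - frag_sum g d"
proof -
  show add: "frag_sum g (c + d) = frag_sum g c + frag_sum g d" for c d
  proof -
    let ?S = "Poly_Mapping.keys c \<union> Poly_Mapping.keys d"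
    have "finite ?S" "Poly_Mapping.keys (c + d) \<subseteq> ?S" by (auto dest: subsetD[OF keys_add])
    then show ?thesis
      by (simp add: frag_sum_superset[of ?S] lookup_add scale_left_distrib sum.distrib)
  qed
  show minus: "frag_sum g (- c) = - frag_sum g c" for c
    by (simp add: frag_sum_def sum_negf)
  show "frag_sum g (c - d) = frag_sum g c - frag_sum g d"
    using add[of c "- d"] minus[of d] by simp
  show "frag_sum g 0 = 0" "frag_sum g (frag_of p) = g p"
    by (simp_all add: frag_sum_def)
qed

definition numerator :: "'a \<Rightarrow> 'a fract \<Rightarrow> 'a" where
  "numerator d k = (THE e. to_fract e = to_fract d * k)"

lemma numeratorI: "to_fract e = to_fract d * k \<Longrightarrow> numerator d k = e"
  unfolding numerator_def by (rule the_equality) (metis to_fract_eq_iff)+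

lemma fract_denominator:
  obtains d :: 'a where "d \<noteq> 0" "\<And>r. to_fract (numerator (r * d) k) = to_fract (r * d) * k"
proof -
  obtain a b where ab: "k = Fract a b" "b \<noteq> 0" by (cases k)
  have "to_fract (numerator (r * b) k) = to_fract (r * b) * k" for r
  proof -
    have "to_fract (r * a) = to_fract (r * b) * k"
      using ab by (simp add: to_fract_def eq_fract)
    then show ?thesis using numeratorI by metis
  qed
  then show thesis using that ab by blast
qed

text \<open>
  \<^term>\<open>numerator\<close> is arbitrary on denominators not cleared by its first argument. Quantifying over
  all multiples of \<open>d\<close> makes the property additive in \<open>c\<close>.
\<close>

lemma tensor_kernel_clear_denominators:
  assumes "c \<in> ker_tensor"
  obtains d where "d \<noteq> 0" "\<And>r. frag_sum (\<lambda>(k, m). scale (numerator (r * d) k) m) c \<in> torsion"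
proof -
  \<comment> \<open>\<open>?F e\<close> stands for multiplication by \<open>e\<close>, sending k
    \<otimes> m to (e k) m whenever \<open>e\<close> clears the denominator of
    \<open>k\<close>.\<close>
  let ?F = "\<lambda>e. frag_sum (\<lambda>(k, m). scale (numerator e k) m)"
  from assms have "\<exists>d. d \<noteq> 0 \<and> (\<forall>r. ?F (r * d) c \<in> torsion)"
  proof (induction rule: tensor_kernel_induct)
    case zero
    show ?case by (rule exI[of _ 1]) (simp add: subspace_0 subspace_torsion)
  next
    case (minus x)
    then show ?case by (auto simp: subspace_neg subspace_torsion)
  next
    case (add x y)
    then obtain d e where *: "d \<noteq> 0" "e \<noteq> 0" "\<And>r. ?F (r * d) x \<in> torsion" "\<And>r. ?F (r * e) y \<in> torsion"
      by blast
    have "?F (r * (d * e)) (x + y) \<in> torsion" for r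
      using *(3)[of "r * e"] *(4)[of "r * d"] subspace_add[OF subspace_torsion]
      by (simp add: mult_ac)
    then show ?case using *(1,2) by (intro exI[of _ "d * e"]) auto
  next
    case (left k k' m)
    obtain d where d: "d \<noteq> 0" "\<And>r. to_fract (numerator (r * d) k) = to_fract (r * d) * k"
      using fract_denominator[where k = k] by blast
    obtain d' where d': "d' \<noteq> 0" "\<And>r. to_fract (numerator (r * d') k') = to_fract (r * d') * k'"
      using fract_denominator[where k = k'] by blast
    have "numerator (r * (d * d')) (k + k') = numerator (r * (d * d')) k + numerator (r * (d * d')) k'" for r
      using d(2)[of "r * d'"] d'(2)[of "r * d"] by (intro numeratorI) (simp add: algebra_simps)
    then show ?case
      using d(1) d'(1)
      by (intro exI[of _ "d * d'"]) (simp add: scale_left_distrib subspace_0 subspace_torsion)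
  next
    case (right k m m')
    show ?case by (rule exI[of _ 1]) (simp add: scale_right_distrib subspace_0 subspace_torsion)
  next
    case (balanced k a m)
    obtain d where d: "d \<noteq> 0" "\<And>r. to_fract (numerator (r * d) k) = to_fract (r * d) * k"
      using fract_denominator[where k = k] by blast
    have "numerator (r * d) (k * to_fract a) = numerator (r * d) k * a" for r
      using d(2)[of r] by (intro numeratorI) (simp add: algebra_simps)
    then show ?case
      using d(1) by (intro exI[of _ d]) (simp add: subspace_0 subspace_torsion)
  qed
  then show thesis using that by blast
qed

lemma tensor_kernel_imp_dependent:
  assumes "frag_of (k, x) + frag_of (l, y) \<in> ker_tensor" "k \<noteq> 0 \<or> l \<noteq> 0"
  obtains a b where "a \<noteq> 0 \<or> b \<noteq> 0" "scale a x + scale b y = 0"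
proof -
  obtain d where d: "d \<noteq> 0" "\<And>r. frag_sum (\<lambda>(k, m). scale (numerator (r * d) k) m)
      (frag_of (k, x) + frag_of (l, y)) \<in> torsion"
    using tensor_kernel_clear_denominators[OF assms(1)] by blast
  obtain u where u: "u \<noteq> 0" "\<And>r. to_fract (numerator (r * u) k) = to_fract (r * u) * k"
    using fract_denominator[where k = k] by blast
  obtain v where v: "v \<noteq> 0" "\<And>r. to_fract (numerator (r * v) l) = to_fract (r * v) * l"
    using fract_denominator[where k = l] by blast
  \<comment> \<open>The factors \<open>u\<close> and \<open>v\<close> clear \<open>k\<close> and
    \<open>l\<close>, so \<open>a\<close> and \<open>b\<close> are true multiples of them and not
    both zero; \<open>d\<close> puts the combination into the torsion.\<close>
  define a b where "a = numerator (u * v * d) k" and "b = numerator (u * v * d) l"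
  have "to_fract a = to_fract (u * v * d) * k" "to_fract b = to_fract (u * v * d) * l"
    using u(2)[of "v * d"] v(2)[of "u * d"] by (simp_all add: a_def b_def mult_ac)
  then have ab: "a \<noteq> 0 \<or> b \<noteq> 0"
    using assms(2) u(1) v(1) d(1) by (metis mult_eq_0_iff to_fract_eq_0_iff)
  have "scale a x + scale b y \<in> torsion" using d(2)[of "u * v"] by (simp add: a_def b_def)
  then obtain s where "s \<noteq> 0" "scale s (scale a x + scale b y) = 0" by (rule torsionE)
  then show thesis using that[of "s * a" "s * b"] ab by (simp add: scale_right_distrib)
qed

section \<open>Generating sets, dimension and rank\<close>

lemma pure_tensor_scale:
  "tensor_class (frag_of (k, scale d m)) = to_fract d \<odot>\<^bsub>fract_tensor scale\<^esub> tensor_class (frag_of (k, m))"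
  using tensor_kernel_minus[OF tensor_kernel_balanced[of k d m]]
  by (simp add: smult_fract_tensor tensor_class_eq_iff mult.commute)

lemma pure_tensor_add:
  "tensor_class (frag_of (k, m + m')) =
     tensor_class (frag_of (k, m)) \<oplus>\<^bsub>fract_tensor scale\<^esub> tensor_class (frag_of (k, m'))"
  using tensor_kernel_right[of k m m'] by (simp add: add_fract_tensor tensor_class_eq_iff algebra_simps)

text \<open>Every pure tensor k \<otimes> m is \<open>k\<close> times 1 \<otimes> m, and differences
  of pure tensors exhaust the free group, so spanning the tensors 1 \<otimes> m is enough.\<close>

lemma fract_tensor_gen_set:
  assumes A: "A \<subseteq> carrier (fract_tensor scale)"
    and pure: "\<And>m. tensor_class (frag_of (1, m)) \<in> LinearCombinations.module.span class_ring (fract_tensor scale) A"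
  shows "LinearCombinations.module.gen_set class_ring (fract_tensor scale) A"
proof -
  interpret V: vectorspace "class_ring :: 'a fract ring" "fract_tensor scale"
    by (rule vectorspace_fract_tensor)
  interpret W: submodule "class_ring :: 'a fract ring" "V.span A" "fract_tensor scale"
    by (rule V.span_is_submodule[OF A])
  have "tensor_class c \<in> V.span A" for c
  proof (induction c rule: frag_induct)
    case zero
    then show ?case using W.zero_closed by (simp add: zero_fract_tensor)
  next
    case (of p)
    obtain k m where p: "p = (k, m)" by (cases p)
    have "k \<odot>\<^bsub>fract_tensor scale\<^esub> tensor_class (frag_of (1, m)) \<in> V.span A"
      by (rule W.smult_closed) (use pure in auto)
    then show ?case by (simp add: p smult_fract_tensor)
  next
    case (diff a b)
    have "tensor_class (a - b) = tensor_class a \<oplus>\<^bsub>fract_tensor scale\<^esub> (-1) \<odot>\<^bsub>fract_tensor scale\<^esub> tensor_class b"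
    proof -
      \<comment> \<open>The scalar -1 acts as negation modulo the kernel: distributivity at 1 + (-1)
        is combined with the vanishing of \<open>mult_left 0 b\<close>.\<close>
      have "mult_left (1 + -1) b - (mult_left 1 b + mult_left (-1) b) \<in> ker_tensor"
        by (rule mult_left_distrib)
      moreover have "mult_left 0 b \<in> ker_tensor"
        using mult_left_distrib[of 0 0 b] tensor_kernel_minus by fastforce
      ultimately have "- b - mult_left (-1) b \<in> ker_tensor"
        using tensor_kernel_diff by (fastforce simp: mult_left_one algebra_simps)
      then show ?thesis by (simp add: smult_fract_tensor add_fract_tensor tensor_class_eq_iff)
    qed
    also have "\<dots> \<in> V.span A"
      using diff by (intro W.m_closed W.smult_closed) auto
    finally show ?case .
  qed
  then show ?thesis
    using W.subset by (auto simp: carrier_fract_tensor)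
qed

lemma fract_tensor_finite_gen_set:
  assumes "finitely_generated_module scale"
  obtains A where "finite A" "A \<subseteq> carrier (fract_tensor scale)"
    "LinearCombinations.module.gen_set class_ring (fract_tensor scale) A"
proof -
  interpret V: vectorspace "class_ring :: 'a fract ring" "fract_tensor scale"
    by (rule vectorspace_fract_tensor)
  obtain S where S: "finite S" "span S = UNIV"
    using assms unfolding finitely_generated_module_def by blast
  define A where "A = (\<lambda>s. tensor_class (frag_of (1, s))) ` S"
  have A: "A \<subseteq> carrier (fract_tensor scale)" unfolding A_def carrier_fract_tensor by blast
  interpret W: submodule "class_ring :: 'a fract ring" "V.span A" "fract_tensor scale"
    by (rule V.span_is_submodule[OF A])
  have "tensor_class (frag_of (1, m)) \<in> V.span A" for m
  proof -
    have "m \<in> span S" using S(2) by simp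
    then show ?thesis
    proof (induction m rule: span_induct_alt)
      case base
      have "tensor_class (frag_of (1, 0)) = to_fract 0 \<odot>\<^bsub>fract_tensor scale\<^esub> tensor_class (frag_of (1, 0))"
        using pure_tensor_scale[of 1 0 0] by simp
      also have "\<dots> = \<zero>\<^bsub>fract_tensor scale\<^esub>"
        using V.smult_l_null[of "tensor_class (frag_of (1, 0))"] by (simp add: carrier_fract_tensor)
      finally show ?case using W.zero_closed by simp
    next
      case (step d s m)
      have "tensor_class (frag_of (1, s)) \<in> V.span A"
        using V.in_own_span[OF A] step(1) unfolding A_def by blast
      then show ?case
        using step(2) unfolding pure_tensor_add pure_tensor_scale
        by (intro W.m_closed W.smult_closed) auto
    qed
  qed
  then have "V.gen_set A" by (rule fract_tensor_gen_set[OF A])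
  then show thesis using that A S(1) unfolding A_def by blast
qed

lemma module_rank_le_one_imp_dependent:
  assumes fg: "finitely_generated_module scale" and rank: "module_rank scale \<le> 1"
  shows "pairwise_dependent"
proof -
  interpret V: vectorspace "class_ring :: 'a fract ring" "fract_tensor scale"
    by (rule vectorspace_fract_tensor)
  let ?V = "fract_tensor scale"
  let ?gen = "\<lambda>n A. finite A \<and> card A = n \<and> A \<subseteq> carrier ?V \<and> V.gen_set A"
  \<comment> \<open>The dimension is a least number, so a generating set of that size is available
    only once some finite one is known.\<close>
  have "\<exists>n A. ?gen n A" using fract_tensor_finite_gen_set[OF fg] by metis
  then have "\<exists>A. ?gen V.dim A" unfolding V.dim_def by (rule LeastI_ex)
  then obtain A where A: "finite A" "card A \<le> 1" "A \<subseteq> carrier ?V" "V.gen_set A"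
    using rank unfolding module_rank_def by auto
  obtain v where v: "v \<in> carrier ?V" "A \<subseteq> {v}"
  proof (cases "A = {}")
    case True
    then show thesis using that V.zero_closed by blast
  next
    case False
    then obtain v where "A = {v}"
      using A(1,2) by (metis One_nat_def card_1_singletonE card_0_eq le_Suc_eq le_zero_eq)
    then show thesis using that A(3) by blast
  qed
  \<comment> \<open>The line through \<open>v\<close> is a subspace containing the generating set
    \<open>A\<close>, hence the whole space.\<close>
  let ?L = "(\<lambda>k. k \<odot>\<^bsub>?V\<^esub> v) ` UNIV"
  have "submodule (class_ring :: 'a fract ring) ?L ?V"
  proof (unfold_locales)
    show "?L \<subseteq> carrier ?V" using v(1) by auto
    show "\<zero>\<^bsub>?V\<^esub> \<in> ?L" using V.smult_l_null[OF v(1)] by (metis UNIV_I image_eqI class_ring_simps(5))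
  next
    fix x y assume "x \<in> ?L" "y \<in> ?L"
    then show "x \<oplus>\<^bsub>?V\<^esub> y \<in> ?L"
      using V.smult_l_distr[OF _ _ v(1)] by (auto intro!: image_eqI)
  next
    fix c x assume "x \<in> ?L"
    then show "c \<odot>\<^bsub>?V\<^esub> x \<in> ?L"
      using V.smult_assoc1[OF _ _ v(1)] by (auto intro!: image_eqI)
  qed
  moreover have "A \<subseteq> ?L"
    using v V.smult_one[OF v(1)] by (auto intro!: image_eqI[of _ _ 1])
  ultimately have line: "\<exists>k. w = k \<odot>\<^bsub>?V\<^esub> v" if "w \<in> carrier ?V" for w
    using V.span_is_subset[of A ?L] A(4) that by auto
  show "pairwise_dependent"
    unfolding pairwise_dependent_def
  proof (intro allI)
    fix x y
    let ?p = "\<lambda>m. tensor_class (frag_of (1, m))"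
    obtain k l where kl: "?p x = k \<odot>\<^bsub>?V\<^esub> v" "?p y = l \<odot>\<^bsub>?V\<^esub> v"
      using line[of "?p x"] line[of "?p y"] by (auto simp: carrier_fract_tensor)
    obtain s t :: "'a fract" where st: "s \<noteq> 0 \<or> t \<noteq> 0" "s * k + t * l = 0"
    proof (cases "k = 0 \<and> l = 0")
      case True
      then show thesis using that[of 1 0] by simp
    next
      case False
      then show thesis using that[of l "- k"] by auto
    qed
    have "tensor_class (frag_of (s, x) + frag_of (t, y)) = s \<odot>\<^bsub>?V\<^esub> ?p x \<oplus>\<^bsub>?V\<^esub> t \<odot>\<^bsub>?V\<^esub> ?p y"
      by (simp add: smult_fract_tensor add_fract_tensor)
    also have "\<dots> = (s * k + t * l) \<odot>\<^bsub>?V\<^esub> v"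
      using V.smult_assoc1[of s k v] V.smult_assoc1[of t l v] V.smult_l_distr[of "s * k" "t * l" v] v(1)
      by (simp add: kl)
    also have "\<dots> = tensor_class 0"
      using V.smult_l_null[OF v(1)] by (simp add: st zero_fract_tensor)
    finally have "frag_of (s, x) + frag_of (t, y) \<in> ker_tensor" by (simp add: tensor_class_eq_iff)
    then show "\<exists>a b. (a \<noteq> 0 \<or> b \<noteq> 0) \<and> scale a x + scale b y = 0"
      using tensor_kernel_imp_dependent[OF _ st(1)] by blast
  qed
qed

text \<open>Some \<open>x\<close> has the property that every \<open>m\<close> satisfies a m = b x
  with \<open>a\<close> nonzero: any non-torsion element, or 0 if all is torsion. Dividing by
  \<open>a\<close> in K shows that 1 \<otimes> x spans.\<close>

lemma dependent_imp_module_rank_le_one: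
  assumes dep: "pairwise_dependent"
  shows "module_rank scale \<le> 1"
proof -
  interpret V: vectorspace "class_ring :: 'a fract ring" "fract_tensor scale"
    by (rule vectorspace_fract_tensor)
  let ?V = "fract_tensor scale"
  have "\<exists>x. \<forall>m. \<exists>a b. a \<noteq> 0 \<and> scale a m = scale b x"
  proof (cases "torsion = UNIV")
    case True
    have "\<exists>a. a \<noteq> 0 \<and> scale a m = scale 0 0" for m
    proof -
      have "m \<in> torsion" using True by simp
      then obtain a where "a \<noteq> 0" "scale a m = 0" by (rule torsionE)
      then show ?thesis by auto
    qed
    then show ?thesis by blast
  next
    case False
    then obtain x where x: "x \<notin> torsion" by blast
    have "\<exists>a b. a \<noteq> 0 \<and> scale a m = scale b x" for m
    proof -
      obtain a b where ab: "a \<noteq> 0 \<or> b \<noteq> 0" "scale a m + scale b x = 0"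
        using dep unfolding pairwise_dependent_def by blast
      then have "a \<noteq> 0" using x torsionI[of b x] by auto
      moreover have "scale a m = scale (- b) x" using ab(2) by (simp add: eq_neg_iff_add_eq_0)
      ultimately show ?thesis by blast
    qed
    then show ?thesis by blast
  qed
  then obtain x where x: "\<And>m. \<exists>a b. a \<noteq> 0 \<and> scale a m = scale b x" by blast
  define v where "v = tensor_class (frag_of (1, x))"
  have v: "{v} \<subseteq> carrier ?V" by (simp add: v_def carrier_fract_tensor)
  interpret W: submodule "class_ring :: 'a fract ring" "V.span {v}" ?V
    by (rule V.span_is_submodule[OF v])
  have "tensor_class (frag_of (1, m)) \<in> V.span {v}" for m
  proof -
    obtain a b where ab: "a \<noteq> 0" "scale a m = scale b x" using x by blast
    let ?p = "tensor_class (frag_of (1, m))"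
    have p: "?p \<in> carrier ?V" by (simp add: carrier_fract_tensor)
    have eq: "to_fract a \<odot>\<^bsub>?V\<^esub> ?p = to_fract b \<odot>\<^bsub>?V\<^esub> v"
      unfolding v_def by (simp only: ab(2) flip: pure_tensor_scale)
    have "?p = inverse (to_fract a) \<odot>\<^bsub>?V\<^esub> (to_fract a \<odot>\<^bsub>?V\<^esub> ?p)"
      using V.smult_assoc1[OF _ _ p, of "inverse (to_fract a)" "to_fract a"] V.smult_one[OF p] ab(1)
      by simp
    also have "\<dots> \<in> V.span {v}"
      unfolding eq using V.in_own_span[OF v] by (intro W.smult_closed) auto
    finally show ?thesis .
  qed
  then have "V.gen_set {v}" by (rule fract_tensor_gen_set[OF v])
  then have "V.dim \<le> card {v}" using v by (intro V.gen_ge_dim) auto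
  then show "module_rank scale \<le> 1" by (simp add: module_rank_def)
qed

lemma module_rank_le_one_iff:
  assumes "finitely_generated_module scale"
  shows "module_rank scale \<le> 1 \<longleftrightarrow> pairwise_dependent"
  using assms module_rank_le_one_imp_dependent dependent_imp_module_rank_le_one by blast

end

theorem theorem10p4:
  fixes scale :: "'a::idom \<Rightarrow> 'b::ab_group_add \<Rightarrow> 'b"
  assumes "dedekind_domain TYPE('a)"
    and "\<not> field (class_ring :: 'a ring)"
    and "Modules.module scale"
    and "finitely_generated_module scale"
  shows "C4_star_module scale UNIV \<longleftrightarrow>
           module_rank scale \<le> 1 \<and> C4_star_module scale (torsion_submodule scale)"
proof -
  interpret idom_module scale
    using assms(3) by (rule idom_module.intro)
  have "C4_star_module scale torsion" if "C4_star_module scale UNIV"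
    using that unfolding C4_star_module_def by auto
  then show ?thesis
    using C4_star_imp_pairwise_dependent[OF _ assms(2)]
      C4_star_torsion_imp_C4_star[OF assms(1,4)] module_rank_le_one_iff[OF assms(4)]
    by blast
qed

end
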